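(* Let $\delta>0$ be fixed and let $c=c(n)$ be a positive-integer-valued function of the positive integer $n$ such that $c(n)= O(n^{1-\delta})$ as $n\to\infty$, and such that $c(n)\mid 2n$ for infinitely many $n$. For each $n$ with $c(n)\mid 2n$ and $2n/c(n)\ge 2$, let $K_{(2n/c)\times c}$ be the complete multipartite graph on $2n$ vertices with $2n/c$ partition classes of $c=c(n)$ vertices each, and let $M=M_n$ be a perfect matching in $K_{(2n/c)\times c}$. Then $$\lim_{\substack{n\to\infty\\ c\mid 2n}}\frac{\mathrm{pm}(K_{(2n/c)\times c}-M)}{\mathrm{pm}(K_{(2n/c)\times c})}=e^{-1/2}.$$
   Context: Graphs are finite and simple, with labelled vertices. For a graph $G$, $\mathrm{pm}(G)$ denotes the number of perfect matchings of $G$. For a set $M$ of edges of $G$, $G-M$ is the graph with the same vertex set as $G$ and edge set $E(G)\setminus M$. The complete multipartite graph has as its edges exactly all pairs of vertices lying in different partition classes. The limit is taken as $n\to\infty$ through integers $n$ with $c(n)\mid 2n$, and is asserted for every choice of the perfect matchings $M_n$. *)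

theory Defs
  imports Complex_Main "HOL-Library.Landau_Symbols"
begin

text \<open>A finite simple graph is given by its vertex set \<open>V\<close> and its edge set \<open>E\<close>, a set of
  two-element subsets of \<open>V\<close>.\<close>

definition simple_graph :: "'a set \<Rightarrow> 'a set set \<Rightarrow> bool" where
  "simple_graph V E \<longleftrightarrow> finite V \<and> (\<forall>e\<in>E. e \<subseteq> V \<and> card e = 2)"

definition perfect_matching :: "'a set \<Rightarrow> 'a set set \<Rightarrow> 'a set set \<Rightarrow> bool" where
  "perfect_matching V E M \<longleftrightarrow> M \<subseteq> E \<and> (\<forall>v\<in>V. \<exists>!e. e \<in> M \<and> v \<in> e)"

definition pm :: "'a set \<Rightarrow> 'a set set \<Rightarrow> nat" where
  "pm V E = card {M. perfect_matching V E M}"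

text \<open>The complete multipartite graph with \<open>r\<close> classes of \<open>c\<close> vertices each: the vertex \<open>(i, j)\<close>
  is the \<open>j\<close>-th vertex of the \<open>i\<close>-th class.\<close>

definition multipartite_verts :: "nat \<Rightarrow> nat \<Rightarrow> (nat \<times> nat) set" where
  "multipartite_verts r c = {..<r} \<times> {..<c}"

definition multipartite_edges :: "nat \<Rightarrow> nat \<Rightarrow> (nat \<times> nat) set set" where
  "multipartite_edges r c =
     {{u, v} | u v. u \<in> multipartite_verts r c \<and> v \<in> multipartite_verts r c \<and> fst u \<noteq> fst v}"

lemma card_multipartite_verts: "card (multipartite_verts r c) = r * c"
  by (simp add: multipartite_verts_def)

lemma simple_graph_multipartite:
  "simple_graph (multipartite_verts r c) (multipartite_edges r c)"
  unfolding simple_graph_def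
proof (intro conjI ballI)
  show "finite (multipartite_verts r c)"
    by (simp add: multipartite_verts_def)
next
  fix e assume "e \<in> multipartite_edges r c"
  then obtain u v where "e = {u, v}" "u \<in> multipartite_verts r c"
      "v \<in> multipartite_verts r c" "fst u \<noteq> fst v"
    unfolding multipartite_edges_def by blast
  moreover from this have "u \<noteq> v" by blast
  ultimately show "e \<subseteq> multipartite_verts r c" "card e = 2"
    by simp_all
qed

end

theory Submission imports Defs "HOL-Library.Disjoint_Sets" "HOL-Real_Asymp.Real_Asymp" begin

text \<open>Delete the edges of \<open>M\<close> one at a time. It is enough that in every graph met on the way, each
  edge \<open>uv\<close> lies in a proportion \<open>(1 + o(1)) / (2n)\<close> of the perfect matchings, uniformly: the ratio is
  then a product of \<open>n\<close> factors \<open>1 - (1 + o(1)) / (2n)\<close> and tends to \<open>exp (- 1 / 2)\<close>. The proportion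
  comes from switching \<open>uv, xy\<close> to \<open>ux, vy\<close>, and only needs that each vertex has at most
  \<open>d = o(n)\<close> non-neighbours. A perfect matching containing \<open>uv\<close> has between \<open>2n - 2 - 2d\<close> and
  \<open>2n - 2\<close> switchings, and each perfect matching avoiding \<open>uv\<close> arises exactly once, unless the
  partners \<open>x\<close> of \<open>u\<close> and \<open>y\<close> of \<open>v\<close> are non-adjacent. That exception has proportion \<open>O(d / n)\<close>: given
  \<open>ux\<close> there are at most \<open>d\<close> such \<open>y\<close>, and by the upper bound, applied after removing \<open>u\<close> and \<open>x\<close>,
  each of them has proportion \<open>O(1 / n)\<close>. All counts are read off from the expansion of the
  number of perfect matchings along the edges at one vertex.\<close>

section \<open>Expanding the number of perfect matchings at a vertex\<close>

text \<open>\<open>E \<inter> Pow S\<close> is the edge set of the subgraph induced on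
  \<open>S\<close>, so vertices are deleted by shrinking \<open>S\<close> alone while
  \<open>E\<close> stays fixed.\<close>

definition pm_on :: "'a set set \<Rightarrow> 'a set \<Rightarrow> nat" where
  "pm_on E S = pm S (E \<inter> Pow S)"

lemma perfect_matching_insert:
  assumes "perfect_matching (S - {u, x}) (E \<inter> Pow (S - {u, x})) M"
    and "u \<in> S" "x \<in> S" "{u, x} \<in> E"
  shows "perfect_matching S (E \<inter> Pow S) (insert {u, x} M)"
  unfolding perfect_matching_def
proof (intro conjI ballI)
  have sub: "M \<subseteq> E \<inter> Pow (S - {u, x})"
    using assms(1) by (simp add: perfect_matching_def)
  then show "insert {u, x} M \<subseteq> E \<inter> Pow S"
    using assms by auto
  fix w assume "w \<in> S"
  show "\<exists>!e. e \<in> insert {u, x} M \<and> w \<in> e"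
  proof (cases "w \<in> {u, x}")
    case True
    then show ?thesis using sub by blast
  next
    case False
    then have "\<exists>!e. e \<in> M \<and> w \<in> e"
      using assms(1) \<open>w \<in> S\<close> by (simp add: perfect_matching_def)
    then show ?thesis using False by (metis insert_iff)
  qed
qed

lemma perfect_matching_remove:
  assumes M: "perfect_matching S (E \<inter> Pow S) M" and ux: "{u, x} \<in> M" "u \<in> S" "x \<in> S"
  shows "perfect_matching (S - {u, x}) (E \<inter> Pow (S - {u, x})) (M - {{u, x}})"
  unfolding perfect_matching_def
proof (intro conjI ballI)
  have sub: "M \<subseteq> E \<inter> Pow S" and un: "\<And>v. v \<in> S \<Longrightarrow> \<exists>!e. e \<in> M \<and> v \<in> e"
    using M by (auto simp: perfect_matching_def)
  have "u \<notin> e \<and> x \<notin> e" if "e \<in> M" "e \<noteq> {u, x}" for e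
    using that un[OF ux(2)] un[OF ux(3)] ux(1) by blast
  then show "M - {{u, x}} \<subseteq> E \<inter> Pow (S - {u, x})"
    using sub by blast
  fix w assume w: "w \<in> S - {u, x}"
  then have "\<exists>!e. e \<in> M \<and> w \<in> e" using un by blast
  moreover have "w \<notin> {u, x}" using w by blast
  ultimately show "\<exists>!e. e \<in> M - {{u, x}} \<and> w \<in> e"
    by (metis Diff_iff singletonD)
qed

text \<open>Sort the perfect matchings by the partner \<open>x\<close> of \<open>u\<close>;
  inserting and removing \<open>{u, x}\<close> are inverse to each other.\<close>

lemma perfect_matchings_expand:
  assumes "u \<in> S" and E2: "\<forall>e\<in>E. card e = 2"
  shows "{M. perfect_matching S (E \<inter> Pow S) M} =
    (\<Union>x\<in>{x \<in> S. {u, x} \<in> E}. insert {u, x} `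
       {M. perfect_matching (S - {u, x}) (E \<inter> Pow (S - {u, x})) M})"
proof (intro equalityI subsetI)
  fix M assume "M \<in> {M. perfect_matching S (E \<inter> Pow S) M}"
  then have M: "perfect_matching S (E \<inter> Pow S) M" by simp
  then have sub: "M \<subseteq> E \<inter> Pow S" by (simp add: perfect_matching_def)
  obtain e where e: "e \<in> M" "u \<in> e"
    using M \<open>u \<in> S\<close> unfolding perfect_matching_def by blast
  then have "card e = 2" using sub E2 by blast
  then obtain x where x: "e = {u, x}"
    using e(2) by (auto simp: card_2_iff)
  have xS: "x \<in> S" "{u, x} \<in> E" using e x sub by auto
  have "M = insert {u, x} (M - {{u, x}})" using e x by blast
  then show "M \<in> (\<Union>x\<in>{x \<in> S. {u, x} \<in> E}. insert {u, x} `
       {M. perfect_matching (S - {u, x}) (E \<inter> Pow (S - {u, x})) M})"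
    using perfect_matching_remove[OF M _ \<open>u \<in> S\<close> xS(1)] e x xS by blast
next
  fix M assume "M \<in> (\<Union>x\<in>{x \<in> S. {u, x} \<in> E}. insert {u, x} `
       {M. perfect_matching (S - {u, x}) (E \<inter> Pow (S - {u, x})) M})"
  then show "M \<in> {M. perfect_matching S (E \<inter> Pow S) M}"
    using perfect_matching_insert[OF _ \<open>u \<in> S\<close>] by blast
qed

lemma finite_perfect_matchings:
  "finite S \<Longrightarrow> finite {M. perfect_matching S (E \<inter> Pow S) M}"
  by (rule finite_subset[of _ "Pow (Pow S)"]) (auto simp: perfect_matching_def)

lemma pm_on_expand:
  assumes S: "finite S" "u \<in> S" and E2: "\<forall>e\<in>E. card e = 2"
  shows "pm_on E S = (\<Sum>x | x \<in> S \<and> {u, x} \<in> E. pm_on E (S - {u, x}))"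
proof -
  let ?P = "\<lambda>S. {M. perfect_matching S (E \<inter> Pow S) M}"
  \<comment> \<open>No matching of \<open>S - {u, x}\<close> has an edge at \<open>u\<close>. This
    makes the families for different \<open>x\<close> disjoint, and each insertion
    injective.\<close>
  have notin: "e \<notin> M" if "M \<in> ?P (S - {u, x})" "u \<in> e" for M x e
    using that by (auto simp: perfect_matching_def)
  have "card (?P S) = (\<Sum>x | x \<in> S \<and> {u, x} \<in> E. card (insert {u, x} ` ?P (S - {u, x})))"
    unfolding perfect_matchings_expand[OF S(2) E2]
  proof (rule card_UN_disjoint)
    show "\<forall>x\<in>{x \<in> S. {u, x} \<in> E}. \<forall>y\<in>{x \<in> S. {u, x} \<in> E}. x \<noteq> y \<longrightarrow>
      insert {u, x} ` ?P (S - {u, x}) \<inter> insert {u, y} ` ?P (S - {u, y}) = {}"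
    proof (intro ballI impI)
      fix x y :: 'a assume "x \<noteq> y"
      then have "{u, x} \<noteq> {u, y}" by (auto simp: doubleton_eq_iff)
      then show "insert {u, x} ` ?P (S - {u, x}) \<inter> insert {u, y} ` ?P (S - {u, y}) = {}"
        using notin by (smt (verit) disjoint_iff image_iff insertI1 insertE)
    qed
  qed (use S in \<open>auto intro!: finite_perfect_matchings\<close>)
  also have "\<dots> = (\<Sum>x | x \<in> S \<and> {u, x} \<in> E. card (?P (S - {u, x})))"
  proof (intro sum.cong refl card_image inj_onI)
    fix x M N assume "M \<in> ?P (S - {u, x})" "N \<in> ?P (S - {u, x})"
      "insert {u, x} M = insert {u, x} N"
    then show "M = N" using notin by (metis insertI1 insert_ident)
  qed
  finally show ?thesis by (simp add: pm_on_def pm_def)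
qed

text \<open>Expand at \<open>u\<close> with and without the edge: only the term for partner
  \<open>v\<close> disappears, since all other terms live on vertex sets that no longer contain
  \<open>u\<close>.\<close>

lemma pm_on_remove_edge:
  assumes S: "finite S" "u \<in> S" "v \<in> S" and E2: "\<forall>e\<in>E. card e = 2" and uv: "{u, v} \<in> E"
  shows "pm_on E S = pm_on (E - {{u, v}}) S + pm_on E (S - {u, v})"
proof -
  have same: "pm_on (E - {{u, v}}) (S - {u, x}) = pm_on E (S - {u, x})" for x :: 'a
  proof -
    have "(E - {{u, v}}) \<inter> Pow (S - {u, x}) = E \<inter> Pow (S - {u, x})" by auto
    then show ?thesis by (simp add: pm_on_def)
  qed
  have eq: "{x. x \<in> S \<and> {u, x} \<in> E} = insert v {x. x \<in> S \<and> {u, x} \<in> E - {{u, v}}}"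
    using S uv by (auto simp: doubleton_eq_iff)
  have "pm_on E S = pm_on E (S - {u, v}) +
      (\<Sum>x | x \<in> S \<and> {u, x} \<in> E - {{u, v}}. pm_on E (S - {u, x}))"
    unfolding pm_on_expand[OF S(1,2) E2] eq using S by (subst sum.insert) auto
  also have "(\<Sum>x | x \<in> S \<and> {u, x} \<in> E - {{u, v}}. pm_on E (S - {u, x})) =
      pm_on (E - {{u, v}}) S"
    using pm_on_expand[of S u "E - {{u, v}}"] S E2 same by simp
  finally show ?thesis by simp
qed

section \<open>Switchings and the proportion of matchings through an edge\<close>

text \<open>Either \<open>u\<close> is matched to \<open>v\<close>, or expanding at \<open>u\<close>
  and then at \<open>v\<close> records their distinct partners \<open>x\<close> and
  \<open>y\<close>.\<close>

lemma pm_on_double_expand: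
  assumes S: "finite S" "u \<in> S" "v \<in> S" and E2: "\<forall>e\<in>E. card e = 2" and uv: "{u, v} \<in> E"
  defines "T \<equiv> S - {u, v}"
  shows "pm_on E S = pm_on E T +
    (\<Sum>(x, y) | x \<in> T \<and> y \<in> T \<and> x \<noteq> y \<and> {u, x} \<in> E \<and> {v, y} \<in> E. pm_on E (T - {x, y}))"
proof -
  have noloop: "{w} \<notin> E" for w using E2 by fastforce
  then have "u \<noteq> v" using uv by auto
  have eq: "{x. x \<in> S \<and> {u, x} \<in> E} = insert v {x \<in> T. {u, x} \<in> E}"
    using S uv noloop by (auto simp: T_def)
  have "pm_on E S = pm_on E T + (\<Sum>x | x \<in> T \<and> {u, x} \<in> E. pm_on E (S - {u, x}))"
    unfolding pm_on_expand[OF S(1,2) E2] eq using S by (subst sum.insert) (auto simp: T_def)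
  also have "(\<Sum>x | x \<in> T \<and> {u, x} \<in> E. pm_on E (S - {u, x})) =
    (\<Sum>x | x \<in> T \<and> {u, x} \<in> E. \<Sum>y | y \<in> T \<and> x \<noteq> y \<and> {v, y} \<in> E. pm_on E (T - {x, y}))"
  proof (rule sum.cong[OF refl])
    fix x assume x: "x \<in> {x. x \<in> T \<and> {u, x} \<in> E}"
    have "pm_on E (S - {u, x}) =
        (\<Sum>y | y \<in> S - {u, x} \<and> {v, y} \<in> E. pm_on E (S - {u, x} - {v, y}))"
      using x S \<open>u \<noteq> v\<close> by (intro pm_on_expand E2) (auto simp: T_def)
    also have "{y. y \<in> S - {u, x} \<and> {v, y} \<in> E} = {y. y \<in> T \<and> x \<noteq> y \<and> {v, y} \<in> E}"
      using noloop by (auto simp: T_def)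
    also have "(\<lambda>y. S - {u, x} - {v, y}) = (\<lambda>y. T - {x, y})" by (auto simp: T_def)
    finally show "pm_on E (S - {u, x}) =
      (\<Sum>y | y \<in> T \<and> x \<noteq> y \<and> {v, y} \<in> E. pm_on E (T - {x, y}))" .
  qed
  also have "\<dots> = (\<Sum>(x, y) \<in> Sigma {x. x \<in> T \<and> {u, x} \<in> E}
      (\<lambda>x. {y. y \<in> T \<and> x \<noteq> y \<and> {v, y} \<in> E}). pm_on E (T - {x, y}))"
    using S by (subst sum.Sigma) (auto simp: T_def)
  also have "Sigma {x. x \<in> T \<and> {u, x} \<in> E} (\<lambda>x. {y. y \<in> T \<and> x \<noteq> y \<and> {v, y} \<in> E}) =
    {(x, y). x \<in> T \<and> y \<in> T \<and> x \<noteq> y \<and> {u, x} \<in> E \<and> {v, y} \<in> E}" by auto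
  finally show ?thesis .
qed

text \<open>Both sides count a matching of \<open>T\<close> with a marked vertex \<open>x\<close> of
  \<open>A\<close>, the left one by also naming the partner \<open>y\<close> of \<open>x\<close>.
  For \<open>A = T\<close> each matching edge occurs in both orientations, one for each way to
  switch it.\<close>

lemma sum_pm_on_edges:
  assumes "finite T" "A \<subseteq> T" and E2: "\<forall>e\<in>E. card e = 2"
  shows "(\<Sum>(x, y) | x \<in> A \<and> y \<in> T \<and> {x, y} \<in> E. pm_on E (T - {x, y})) = card A * pm_on E T"
proof -
  have "finite A" using assms finite_subset by blast
  have "{(x, y). x \<in> A \<and> y \<in> T \<and> {x, y} \<in> E} = Sigma A (\<lambda>x. {y. y \<in> T \<and> {x, y} \<in> E})" by auto
  then have "(\<Sum>(x, y) | x \<in> A \<and> y \<in> T \<and> {x, y} \<in> E. pm_on E (T - {x, y})) =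
     (\<Sum>x\<in>A. \<Sum>y | y \<in> T \<and> {x, y} \<in> E. pm_on E (T - {x, y}))"
    using assms \<open>finite A\<close> by (simp add: sum.Sigma)
  also have "\<dots> = (\<Sum>x\<in>A. pm_on E T)"
    using assms by (intro sum.cong refl pm_on_expand[symmetric]) auto
  finally show ?thesis by simp
qed

text \<open>In the next lemmas a vertex counts among its own non-neighbours, and \<open>d\<close> bounds their number.\<close>

lemma pm_on_edge_upper:
  assumes S: "finite S" "u \<in> S" "v \<in> S" and E2: "\<forall>e\<in>E. card e = 2" and uv: "{u, v} \<in> E"
    and d: "\<And>x. x \<in> S \<Longrightarrow> card {y \<in> S. {x, y} \<notin> E} \<le> d"
  shows "card S * pm_on E (S - {u, v}) \<le> pm_on E S + (2 * d + 1) * pm_on E (S - {u, v})"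
proof -
  define T where "T = S - {u, v}"
  define g where "g = (\<lambda>(x, y). pm_on E (T - {x, y}))"
  \<comment> \<open>\<open>A\<close> indexes the matchings containing \<open>uv\<close> with an edge \<open>xy\<close> to switch, \<open>B\<close> those avoiding \<open>uv\<close>.\<close>
  define A where "A = {(x, y). x \<in> T \<and> y \<in> T \<and> {x, y} \<in> E}"
  define B where "B = {(x, y). x \<in> T \<and> y \<in> T \<and> x \<noteq> y \<and> {u, x} \<in> E \<and> {v, y} \<in> E}"
  define Nu where "Nu = {x \<in> T. {u, x} \<notin> E}"
  define Nv where "Nv = {x \<in> T. {v, x} \<notin> E}"
  define Au where "Au = {(x, y). x \<in> Nu \<and> y \<in> T \<and> {x, y} \<in> E}"
  define Av where "Av = {(x, y). x \<in> Nv \<and> y \<in> T \<and> {x, y} \<in> E}"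
  have fT: "finite T" using S by (simp add: T_def)
  have fin: "finite A" "finite B" "finite Au" "finite Av"
    by (rule finite_subset[of _ "T \<times> T"]; use fT in \<open>auto simp: A_def B_def Au_def Av_def Nu_def Nv_def\<close>)+
  have noloop: "{w} \<notin> E" for w using E2 by fastforce
  then have "u \<noteq> v" using uv by auto
  have gswap: "g (y, x) = g (x, y)" for x y by (simp add: g_def insert_commute)
  \<comment> \<open>A switch fails only if \<open>x\<close> is a non-neighbour of \<open>u\<close>
    or \<open>y\<close> one of \<open>v\<close>. The second kind is indexed from \<open>y\<close>,
    hence the swap, so that \<open>sum_pm_on_edges\<close> applies to both.\<close>
  have "A \<subseteq> B \<union> (Au \<union> prod.swap ` Av)"
    using noloop by (force simp: A_def B_def Au_def Av_def Nu_def Nv_def insert_commute)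
  then have "sum g A \<le> sum g (B \<union> (Au \<union> prod.swap ` Av))"
    using fin by (intro sum_mono2) auto
  also have "\<dots> \<le> sum g B + (sum g Au + sum g (prod.swap ` Av))"
    by (smt (verit) sum_Un_nat fin finite_UnI finite_imageI add_left_mono diff_le_self le_trans)
  also have "sum g (prod.swap ` Av) = sum g Av"
    by (subst sum.reindex) (auto intro!: sum.cong simp: gswap)
  finally have le: "sum g A \<le> sum g B + (sum g Au + sum g Av)" .
  have gA: "sum g A = card T * pm_on E T"
    unfolding g_def A_def using fT by (intro sum_pm_on_edges E2) auto
  have gAu: "sum g Au = card Nu * pm_on E T" and gAv: "sum g Av = card Nv * pm_on E T"
    unfolding g_def Au_def Av_def using fT by (intro sum_pm_on_edges E2; auto simp: Nu_def Nv_def)+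
  have gB: "pm_on E S = pm_on E T + sum g B"
    unfolding g_def B_def T_def using S E2 uv by (rule pm_on_double_expand)
  have sub1: "insert u Nu \<subseteq> {y \<in> S. {u, y} \<notin> E}" "insert v Nv \<subseteq> {y \<in> S. {v, y} \<notin> E}"
    using S noloop by (auto simp: Nu_def Nv_def T_def)
  have "card (insert u Nu) \<le> d" "card (insert v Nv) \<le> d"
    using card_mono[OF _ sub1(1)] card_mono[OF _ sub1(2)] d[OF S(2)] d[OF S(3)] S(1) by auto
  moreover have "u \<notin> Nu" "v \<notin> Nv" "finite Nu" "finite Nv"
    using fT by (auto simp: Nu_def Nv_def T_def)
  ultimately have "card Nu + card Nv + 2 \<le> 2 * d" by simp
  then have "(card Nu + card Nv + 2) * pm_on E T \<le> 2 * d * pm_on E T"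
    by (rule mult_le_mono1)
  moreover have "card S = card T + 2"
  proof -
    have "S = insert u (insert v T)" using S by (auto simp: T_def)
    moreover have "u \<notin> insert v T" "v \<notin> T" using \<open>u \<noteq> v\<close> by (auto simp: T_def)
    ultimately show ?thesis using fT by simp
  qed
  ultimately show ?thesis
    using le gA gAu gAv gB unfolding T_def[symmetric] by (simp add: algebra_simps)
qed


text \<open>A pair of partners \<open>(x, y)\<close> either is an edge, and then comes from a
  switching, or is exceptional. Given \<open>x\<close> there are at most \<open>d\<close>
  exceptional \<open>y\<close>, each accounting for at most a fraction \<open>1 / k\<close> of the
  matchings containing \<open>ux\<close>. The factor \<open>k\<close> clears this
  denominator.\<close>

lemma pm_on_edge_lower:
  assumes S: "finite S" "u \<in> S" "v \<in> S" and E2: "\<forall>e\<in>E. card e = 2" and uv: "{u, v} \<in> E"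
    and d: "\<And>x. x \<in> S \<Longrightarrow> card {y \<in> S. {x, y} \<notin> E} \<le> d"
    and k: "card S = k + (2 * d + 3)"
  shows "k * pm_on E S \<le> k * (card S - 1) * pm_on E (S - {u, v}) + d * pm_on E S"
proof -
  define T where "T = S - {u, v}"
  define g where "g = (\<lambda>(x, y). pm_on E (T - {x, y}))"
  define A where "A = {(x, y). x \<in> T \<and> y \<in> T \<and> {x, y} \<in> E}"
  define B where "B = {(x, y). x \<in> T \<and> y \<in> T \<and> x \<noteq> y \<and> {u, x} \<in> E \<and> {v, y} \<in> E}"
  define X where "X = {x \<in> T. {u, x} \<in> E}"
  define Y where "Y = (\<lambda>x. {y \<in> T. x \<noteq> y \<and> {v, y} \<in> E \<and> {x, y} \<notin> E})"
  have fT: "finite T" using S by (simp add: T_def)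
  have fin: "finite A" "finite B" "finite (Sigma X Y)"
    by (rule finite_subset[of _ "T \<times> T"]; use fT in \<open>auto simp: A_def B_def X_def Y_def\<close>)+
  have noloop: "{w} \<notin> E" for w using E2 by fastforce
  then have "u \<noteq> v" using uv by auto
  have "B \<subseteq> A \<union> Sigma X Y" by (auto simp: A_def B_def X_def Y_def)
  then have "sum g B \<le> sum g (A \<union> Sigma X Y)"
    using fin by (intro sum_mono2) auto
  also have "\<dots> \<le> sum g A + sum g (Sigma X Y)"
    by (simp add: sum_Un_nat fin)
  finally have le: "sum g B \<le> sum g A + sum g (Sigma X Y)" .
  have gA: "sum g A = card T * pm_on E T"
    unfolding g_def A_def using fT by (intro sum_pm_on_edges E2) auto
  have gB: "pm_on E S = pm_on E T + sum g B"
    unfolding g_def B_def T_def using S E2 uv by (rule pm_on_double_expand)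
  \<comment> \<open>The upper bound is applied to the edge \<open>vy\<close> after removing
    \<open>u\<close> and \<open>x\<close>. Two vertices fewer leave \<open>k + (2 * d + 1)\<close>,
    and the error term \<open>2 * d + 1\<close> cancels exactly.\<close>
  have bound: "k * pm_on E (T - {x, y}) \<le> pm_on E (S - {u, x})" if "x \<in> X" "y \<in> Y x" for x y
  proof -
    have xy: "x \<in> S" "y \<in> S" "x \<noteq> y" "x \<noteq> u" "x \<noteq> v" "y \<noteq> u" "y \<noteq> v" "{v, y} \<in> E"
      using that by (auto simp: X_def Y_def T_def)
    have "card {b \<in> S - {u, x}. {a, b} \<notin> E} \<le> d" if "a \<in> S - {u, x}" for a
      using that S(1) by (intro order.trans[OF card_mono d[of a]]) auto
    then have "card (S - {u, x}) * pm_on E (S - {u, x} - {v, y}) \<le>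
        pm_on E (S - {u, x}) + (2 * d + 1) * pm_on E (S - {u, x} - {v, y})"
      using S xy \<open>u \<noteq> v\<close> E2 by (intro pm_on_edge_upper) auto
    moreover have "card (S - {u, x}) = k + (2 * d + 1)"
      using S xy k by (simp add: card_Diff_subset)
    moreover have "S - {u, x} - {v, y} = T - {x, y}" by (auto simp: T_def)
    ultimately show ?thesis by (simp add: algebra_simps)
  qed
  have "k * sum g (Sigma X Y) = (\<Sum>x\<in>X. \<Sum>y\<in>Y x. k * pm_on E (T - {x, y}))"
    using fT by (subst sum.Sigma) (auto simp: X_def Y_def g_def sum_distrib_left case_prod_beta)
  also have "\<dots> \<le> (\<Sum>x\<in>X. \<Sum>y\<in>Y x. pm_on E (S - {u, x}))"
    using bound by (intro sum_mono) auto
  also have "\<dots> \<le> (\<Sum>x\<in>X. d * pm_on E (S - {u, x}))"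
  proof (rule sum_mono)
    fix x assume "x \<in> X"
    then have "card (Y x) \<le> d"
      using S by (intro order.trans[OF card_mono d[of x]]) (auto simp: X_def Y_def T_def)
    then show "(\<Sum>y\<in>Y x. pm_on E (S - {u, x})) \<le> d * pm_on E (S - {u, x})" by simp
  qed
  \<comment> \<open>Enlarging \<open>X\<close> to all neighbours of \<open>u\<close>, including
    \<open>v\<close>, lets the expansion at \<open>u\<close> reassemble the full count.\<close>
  also have "\<dots> \<le> (\<Sum>x | x \<in> S \<and> {u, x} \<in> E. d * pm_on E (S - {u, x}))"
    using S by (intro sum_mono2) (auto simp: X_def T_def)
  also have "\<dots> = d * pm_on E S"
    unfolding pm_on_expand[OF S(1,2) E2] by (simp add: sum_distrib_left)
  finally have gC: "k * sum g (Sigma X Y) \<le> d * pm_on E S" .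
  \<comment> \<open>\<open>card T\<close> counts the switchings of a matching containing
    \<open>uv\<close>, and the \<open>1\<close> counts that matching itself.\<close>
  have cT: "card S - 1 = card T + 1"
  proof -
    have "S = insert u (insert v T)" using S by (auto simp: T_def)
    moreover have "u \<notin> insert v T" "v \<notin> T" using \<open>u \<noteq> v\<close> by (auto simp: T_def)
    ultimately show ?thesis using fT by simp
  qed
  have "k * pm_on E S \<le> k * (pm_on E T + (card T * pm_on E T + sum g (Sigma X Y)))"
    using le gB gA by (intro mult_le_mono2) simp
  also have "\<dots> \<le> k * (pm_on E T + card T * pm_on E T) + d * pm_on E S"
    using gC by (simp add: distrib_left)
  finally show ?thesis unfolding cT T_def[symmetric] by (simp add: algebra_simps)
qed

text \<open>Deleting \<open>uv\<close> loses exactly the matchings through it. Their proportion is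
  at most \<open>1 / (k + 2)\<close>, as \<open>card S - (2 * d + 1) = k + 2\<close>, and at least
  \<open>(1 - d / k) / (card S - 1)\<close>.\<close>

lemma pm_on_remove_edge_bounds:
  assumes S: "finite S" "u \<in> S" "v \<in> S" and E2: "\<forall>e\<in>E. card e = 2" and uv: "{u, v} \<in> E"
    and d: "\<And>x. x \<in> S \<Longrightarrow> card {y \<in> S. {x, y} \<notin> E} \<le> d"
    and k: "card S = k + (2 * d + 3)" "k > 0"
  shows "real (pm_on (E - {{u, v}}) S) \<le> (1 - (1 - real d / real k) / real (card S - 1)) * real (pm_on E S)"
    and "real (pm_on (E - {{u, v}}) S) \<ge> (1 - 1 / (real k + 2)) * real (pm_on E S)"
proof -
  let ?F = "real (pm_on E S)" and ?P = "real (pm_on E (S - {u, v}))"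
  have eq: "real (pm_on (E - {{u, v}}) S) = ?F - ?P"
    using pm_on_remove_edge[OF S E2 uv] by simp
  have "real (card S * pm_on E (S - {u, v})) \<le> real (pm_on E S + (2 * d + 1) * pm_on E (S - {u, v}))"
    using pm_on_edge_upper[OF S E2 uv d] of_nat_le_iff by blast
  then have "(real k + 2) * ?P \<le> ?F"
    using k by (simp add: algebra_simps)
  then have "?P \<le> ?F / (real k + 2)"
    by (simp add: field_simps)
  then show "real (pm_on (E - {{u, v}}) S) \<ge> (1 - 1 / (real k + 2)) * ?F"
    unfolding eq by (simp add: algebra_simps)
  have "real (k * pm_on E S) \<le> real (k * (card S - 1) * pm_on E (S - {u, v}) + d * pm_on E S)"
    using pm_on_edge_lower[OF S E2 uv d k(1)] of_nat_le_iff by blast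
  then have "k * ?F \<le> k * real (card S - 1) * ?P + d * ?F" by simp
  then have "(1 - real d / real k) * ?F \<le> real (card S - 1) * ?P"
    using k by (simp add: field_simps)
  moreover have "real (card S - 1) > 0" using k by simp
  ultimately have "(1 - real d / real k) / real (card S - 1) * ?F \<le> ?P"
    by (simp add: field_simps)
  then show "real (pm_on (E - {{u, v}}) S) \<le> (1 - (1 - real d / real k) / real (card S - 1)) * ?F"
    unfolding eq by (simp add: algebra_simps)
qed

section \<open>Deleting a whole matching\<close>

text \<open>Since the edges of \<open>F\<close> are disjoint, each vertex loses at most one
  neighbour in the whole process. So \<open>d + 1\<close> bounds the non-neighbours at every stage,
  the same two factors serve for each edge, and \<open>2 * d + 5\<close> is
  \<open>2 * (d + 1) + 3\<close>.\<close>

lemma pm_on_remove_matching_bounds: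
  assumes S: "finite S" and E2: "\<forall>e\<in>E. card e = 2" and ES: "E \<subseteq> Pow S"
    and d: "\<And>x. x \<in> S \<Longrightarrow> card {y \<in> S. {x, y} \<notin> E} \<le> d"
    and k: "card S = k + (2 * d + 5)" "k > 0"
    and F: "finite F" "F \<subseteq> E" "disjoint F"
  shows "pm_on (E - F) S \<le> (1 - (1 - real (d + 1) / real k) / real (card S - 1)) ^ card F * pm_on E S
    \<and> (1 - 1 / (k + 2)) ^ card F * pm_on E S \<le> pm_on (E - F) S"
  using F
proof (induction F)
  case empty
  then show ?case by simp
next
  case (insert e F)
  let ?a = "1 - (1 - real (d + 1) / real k) / real (card S - 1)" and ?b = "1 - 1 / (real k + 2)"
  have IH: "pm_on (E - F) S \<le> ?a ^ card F * pm_on E S"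
      "?b ^ card F * pm_on E S \<le> pm_on (E - F) S"
    using insert by (auto simp: pairwise_insert algebra_simps)
  have "card e = 2" using insert E2 by auto
  then obtain u v where uv: "e = {u, v}" by (auto simp: card_2_iff)
  have uvS: "u \<in> S" "v \<in> S" "{u, v} \<in> E - F" using insert uv ES by auto
  have d': "card {y \<in> S. {x, y} \<notin> E - F} \<le> d + 1" if "x \<in> S" for x
  proof -
    have "card {y \<in> S. {x, y} \<in> F} \<le> 1"
    proof (rule card_le_Suc0_iff_eq[THEN iffD2, unfolded One_nat_def[symmetric]])
      show "\<forall>a\<in>{y \<in> S. {x, y} \<in> F}. \<forall>b\<in>{y \<in> S. {x, y} \<in> F}. a = b"
      proof (intro ballI)
        fix a b assume "a \<in> {y \<in> S. {x, y} \<in> F}" "b \<in> {y \<in> S. {x, y} \<in> F}"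
        then have "{x, a} \<in> F" "{x, b} \<in> F" by auto
        moreover have "{x, a} \<inter> {x, b} \<noteq> {}" by auto
        ultimately have "{x, a} = {x, b}"
          using insert.prems by (meson insertI2 pairwiseD disjnt_def)
        then show "a = b" by (auto simp: doubleton_eq_iff)
      qed
    qed (use S in auto)
    moreover have "{y \<in> S. {x, y} \<notin> E - F} = {y \<in> S. {x, y} \<notin> E} \<union> {y \<in> S. {x, y} \<in> F}"
      using insert.prems by auto
    ultimately show ?thesis
      using d[OF that] card_Un_le[of "{y \<in> S. {x, y} \<notin> E}" "{y \<in> S. {x, y} \<in> F}"] by simp
  qed
  have k': "card S = k + (2 * (d + 1) + 3)" using k by simp
  have E2': "\<forall>e\<in>E - F. card e = 2" using E2 by blast
  note step = pm_on_remove_edge_bounds[OF S uvS(1,2) E2' uvS(3) d' k' k(2)]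
  have eq: "E - insert e F = E - F - {{u, v}}" using uv by auto
  \<comment> \<open>Multiplying the induction hypothesis by \<open>?a\<close> needs
    \<open>?a \<ge> 0\<close>; this estimate gives it whatever the sign of
    \<open>1 - (d + 1) / k\<close>.\<close>
  have "(1 - real (d + 1) / real k) / real (card S - 1) \<le> 1 / real (card S - 1)"
    using k by (intro divide_right_mono) auto
  also have "\<dots> \<le> 1" using k by simp
  finally have a: "?a \<ge> 0" by simp
  have b: "?b \<ge> 0" using k by (simp add: field_simps)
  have "pm_on (E - insert e F) S \<le> ?a * pm_on (E - F) S"
    unfolding eq using step(1) by simp
  also have "\<dots> \<le> ?a * (?a ^ card F * pm_on E S)" using IH(1) a by (rule mult_left_mono)
  finally have 1: "pm_on (E - insert e F) S \<le> ?a ^ card (insert e F) * pm_on E S"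
    using insert by (simp add: mult.assoc)
  have "?b ^ card (insert e F) * pm_on E S = ?b * (?b ^ card F * pm_on E S)"
    using insert by (simp add: mult.assoc)
  also have "\<dots> \<le> ?b * pm_on (E - F) S" using IH(2) b by (rule mult_left_mono)
  also have "\<dots> \<le> pm_on (E - insert e F) S"
    unfolding eq using step(2) by simp
  finally show ?case using 1 by (simp add: algebra_simps)
qed

section \<open>Application to complete multipartite graphs\<close>

lemma disjoint_perfect_matching:
  assumes "perfect_matching V E M" "E \<subseteq> Pow V"
  shows "disjoint M"
proof (rule disjointI)
  fix a b assume ab: "a \<in> M" "b \<in> M" "a \<noteq> b"
  have "x \<in> V" if "x \<in> a" for x
    using that ab(1) assms unfolding perfect_matching_def by blast
  then show "a \<inter> b = {}"
    using ab assms(1) unfolding perfect_matching_def by blast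
qed

lemma card_perfect_matching:
  assumes M: "perfect_matching V E M" and E: "simple_graph V E"
  shows "finite M" "card V = 2 * card M"
proof -
  have sub: "M \<subseteq> E" "E \<subseteq> Pow V" "finite V" "\<forall>e\<in>E. card e = 2"
    using M E by (auto simp: perfect_matching_def simple_graph_def)
  then show "finite M" by (meson finite_Pow_iff finite_subset)
  have "V = \<Union>M"
    using M sub unfolding perfect_matching_def by blast
  moreover have "card (\<Union>M) = sum card M"
    using sub finite_subset by (intro card_Union_disjoint disjoint_perfect_matching[OF M]) blast+
  moreover have "sum card M = (\<Sum>e\<in>M. 2)"
    using sub by (intro sum.cong) auto
  ultimately show "card V = 2 * card M" by simp
qed

text \<open>Non-neighbours lie in the class of \<open>x\<close>, which includes \<open>x\<close>
  itself, so the general bounds apply with \<open>d = c\<close>.\<close>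

lemma card_multipartite_nonneighbours:
  assumes "x \<in> multipartite_verts r c"
  shows "card {y \<in> multipartite_verts r c. {x, y} \<notin> multipartite_edges r c} \<le> c"
proof -
  have "{y \<in> multipartite_verts r c. {x, y} \<notin> multipartite_edges r c} \<subseteq> {fst x} \<times> {..<c}"
  proof
    fix y assume y: "y \<in> {y \<in> multipartite_verts r c. {x, y} \<notin> multipartite_edges r c}"
    then have "fst x = fst y"
      using assms unfolding multipartite_edges_def by blast
    then show "y \<in> {fst x} \<times> {..<c}"
      using y by (cases y) (auto simp: multipartite_verts_def)
  qed
  then show ?thesis using card_mono[of "{fst x} \<times> {..<c}"] by simp
qed

text \<open>The \<open>n\<close> edges of \<open>M\<close> give \<open>n\<close>-th powers of the
  two factors, which are then compared with exponentials.\<close>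

lemma multipartite_ratio_bounds:
  assumes M: "perfect_matching (multipartite_verts r c) (multipartite_edges r c) M"
    and n: "r * c = 2 * n" and k: "2 * n = k + (2 * c + 5)" "k > 0"
  defines "R \<equiv> real (pm (multipartite_verts r c) (multipartite_edges r c - M)) /
               real (pm (multipartite_verts r c) (multipartite_edges r c))"
  shows "exp (- (real n / (real k + 1))) \<le> R"
    and "R \<le> exp (- (real n * (1 - real (c + 1) / real k) / (2 * real n - 1)))"
proof -
  let ?V = "multipartite_verts r c" and ?E = "multipartite_edges r c"
  have sg: "finite ?V" "\<forall>e\<in>?E. card e = 2" "?E \<subseteq> Pow ?V"
    using simple_graph_multipartite[of r c] by (auto simp: simple_graph_def)
  have cM: "finite M" "card M = n"
    using card_perfect_matching[OF M simple_graph_multipartite] n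
    by (simp_all add: card_multipartite_verts)
  have eq: "pm ?V (?E - F) = pm_on (?E - F) ?V" for F
    using sg(3) unfolding pm_on_def by (intro arg_cong[where f = "pm ?V"]) blast
  have cV: "card ?V = k + (2 * c + 5)" using n k card_multipartite_verts by metis
  have "M \<subseteq> ?E" using M by (simp add: perfect_matching_def)
  note bnd = pm_on_remove_matching_bounds[OF sg card_multipartite_nonneighbours cV k(2) cM(1) this
      disjoint_perfect_matching[OF M sg(3)], unfolded cM(2)]
  \<comment> \<open>\<open>M\<close> itself is one of the finitely many perfect matchings, so the
    denominator of \<open>R\<close> is positive.\<close>
  have "finite {N. perfect_matching ?V ?E N}"
    by (rule finite_subset[of _ "Pow ?E"])
      (use sg finite_subset[OF sg(3)] in \<open>auto simp: perfect_matching_def\<close>)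
  then have pos: "pm ?V ?E > 0"
    using M by (auto simp: pm_def card_gt_0_iff)
  have R: "R = real (pm_on (?E - M) ?V) / real (pm_on ?E ?V)"
    using eq[of M] eq[of "{}"] by (simp add: R_def)
  have pos': "real (pm_on ?E ?V) > 0" using pos eq[of "{}"] by simp
  have lo: "(1 - 1 / (real k + 2)) ^ n \<le> R"
    using bnd pos' by (simp add: R pos_le_divide_eq)
  have card1: "real (card ?V - 1) = 2 * real n - 1"
    using cV k by simp
  have up: "R \<le> (1 - (1 - real (c + 1) / real k) / (2 * real n - 1)) ^ n"
    using bnd pos' unfolding card1 by (simp add: R pos_divide_le_eq)
  \<comment> \<open>This is \<open>exp t \<ge> 1 + t\<close> at \<open>t = 1 / (k + 1)\<close>,
    inverted.\<close>
  have "exp (- (1 / (real k + 1))) \<le> 1 - 1 / (real k + 2)"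
  proof -
    have "exp (- (1 / (real k + 1))) = 1 / exp (1 / (real k + 1))"
      by (simp add: exp_minus inverse_eq_divide)
    also have "\<dots> \<le> 1 / (1 + 1 / (real k + 1))"
      by (intro divide_left_mono exp_ge_add_one_self mult_pos_pos add_pos_nonneg) auto
    also have "\<dots> = 1 - 1 / (real k + 2)" by (simp add: field_simps)
    finally show ?thesis .
  qed
  then have "exp (- (1 / (real k + 1))) ^ n \<le> (1 - 1 / (real k + 2)) ^ n"
    by (intro power_mono) auto
  also have "exp (- (1 / (real k + 1))) ^ n = exp (- (real n / (real k + 1)))"
    by (simp flip: exp_of_nat_mult)
  finally show "exp (- (real n / (real k + 1))) \<le> R" using lo by linarith
  \<comment> \<open>Here \<open>1 - ?a \<le> exp (- ?a)\<close>; taking powers also needs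
    \<open>?a \<le> 1\<close>.\<close>
  let ?a = "(1 - real (c + 1) / real k) / (2 * real n - 1)"
  have n2: "2 * real n - 1 \<ge> 1" using k by simp
  have "?a \<le> 1 / (2 * real n - 1)" using n2 by (intro divide_right_mono) auto
  also have "\<dots> \<le> 1" using n2 by simp
  finally have "(1 - ?a) ^ n \<le> exp (- ?a) ^ n"
    using exp_ge_add_one_self[of "- ?a"] by (intro power_mono) auto
  also have "\<dots> = exp (- (real n * (1 - real (c + 1) / real k) / (2 * real n - 1)))"
    by (simp flip: exp_of_nat_mult)
  finally show "R \<le> exp (- (real n * (1 - real (c + 1) / real k) / (2 * real n - 1)))"
    using up by linarith
qed

section \<open>Passage to the limit\<close>

theorem corollary11:
  fixes \<delta> :: real
    and c :: "nat \<Rightarrow> nat"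
    and M :: "nat \<Rightarrow> (nat \<times> nat) set set"
  assumes "\<delta> > 0"
    and "\<And>n. n > 0 \<Longrightarrow> c n > 0"
    and "(\<lambda>n. real (c n)) \<in> O(\<lambda>n. real n powr (1 - \<delta>))"
    and "infinite {n. c n dvd 2 * n}"
    and "\<And>n. n > 0 \<Longrightarrow> c n dvd 2 * n \<Longrightarrow> 2 * n div c n \<ge> 2 \<Longrightarrow>
           perfect_matching (multipartite_verts (2 * n div c n) (c n))
             (multipartite_edges (2 * n div c n) (c n)) (M n)"
  shows "((\<lambda>n. real (pm (multipartite_verts (2 * n div c n) (c n))
                        (multipartite_edges (2 * n div c n) (c n) - M n)) /
               real (pm (multipartite_verts (2 * n div c n) (c n))
                        (multipartite_edges (2 * n div c n) (c n))))
          \<longlongrightarrow> exp (- 1 / 2))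
         (inf sequentially (principal {n. c n dvd 2 * n}))"
proof -
  define x where "x = (\<lambda>n. real (c n) / real n)"
  have "(\<lambda>n. real n powr (1 - \<delta>)) \<in> o(\<lambda>n. real n)"
    using \<open>\<delta> > 0\<close> by real_asymp
  then have "(\<lambda>n. real (c n)) \<in> o(\<lambda>n. real n)"
    using assms(3) landau_o.big_small_trans by blast
  then have x0: "x \<longlonglongrightarrow> 0"
    unfolding x_def by (rule smalloD_tendsto)
  have i0: "(\<lambda>n. 1 / real n) \<longlonglongrightarrow> 0" by real_asymp
  \<comment> \<open>\<open>L\<close> and \<open>U\<close> are the bounds of
    \<open>multipartite_ratio_bounds\<close> for \<open>k = 2 * n - 2 * c n - 5\<close>, divided
    through by \<open>n\<close> to become continuous expressions in \<open>x n\<close> and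
    \<open>1 / n\<close>.\<close>
  define L where "L = (\<lambda>n. exp (- (1 / (2 - 2 * x n - 4 * (1 / real n)))))"
  define U where "U = (\<lambda>n. exp (- ((1 - (x n + 1 / real n) / (2 - 2 * x n - 5 * (1 / real n))) /
    (2 - 1 / real n))))"
  let ?F = "inf sequentially (principal {n. c n dvd 2 * n})"
  have "L \<longlonglongrightarrow> exp (- (1 / (2 - 2 * 0 - 4 * 0)))"
    unfolding L_def by (intro tendsto_intros x0 i0) auto
  then have L: "(L \<longlongrightarrow> exp (- 1 / 2)) ?F"
    by (intro tendsto_mono[OF inf_le1]) simp
  have "U \<longlonglongrightarrow> exp (- ((1 - (0 + 0) / (2 - 2 * 0 - 5 * 0)) / (2 - 0)))"
    unfolding U_def by (intro tendsto_intros x0 i0) auto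
  then have U: "(U \<longlongrightarrow> exp (- 1 / 2)) ?F"
    by (intro tendsto_mono[OF inf_le1]) simp
  \<comment> \<open>The thresholds \<open>1 / 4\<close> and \<open>20\<close> are generous: they
    make \<open>k\<close> positive and give at least two classes, so that \<open>M n\<close> is
    known to be a perfect matching.\<close>
  have "eventually (\<lambda>n. x n < 1 / 4) sequentially"
    using x0 by (rule order_tendstoD) simp
  moreover have "eventually (\<lambda>n::nat. n \<ge> 20) sequentially" by (rule eventually_ge_at_top)
  ultimately have "eventually (\<lambda>n. x n < 1 / 4 \<and> n \<ge> 20) sequentially"
    by (rule eventually_conj)
  then have ev: "eventually (\<lambda>n. (x n < 1 / 4 \<and> n \<ge> 20) \<and> c n dvd 2 * n) ?F"
    unfolding eventually_inf_principal by (rule eventually_mono) simp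
  have bounds: "L n \<le> R n \<and> R n \<le> U n"
    if R: "R = (\<lambda>n. real (pm (multipartite_verts (2 * n div c n) (c n))
                        (multipartite_edges (2 * n div c n) (c n) - M n)) /
               real (pm (multipartite_verts (2 * n div c n) (c n))
                        (multipartite_edges (2 * n div c n) (c n))))"
      and n: "(x n < 1 / 4 \<and> n \<ge> 20) \<and> c n dvd 2 * n" for R n
  proof -
    have n0: "n > 0" using n by simp
    then have "real (c n) < real n / 4" using n n0 by (simp add: x_def divide_less_eq)
    then have cn: "4 * c n < n" by linarith
    then obtain k where k: "2 * n = k + (2 * c n + 5)" "k > 0"
      using n that[of "2 * n - (2 * c n + 5)"] by auto
    have rc: "2 * n div c n * c n = 2 * n" using n by simp
    have "2 * n div c n \<ge> 2"
      using cn assms(2)[OF n0] by (simp add: less_eq_div_iff_mult_less_eq)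
    then have M: "perfect_matching (multipartite_verts (2 * n div c n) (c n))
             (multipartite_edges (2 * n div c n) (c n)) (M n)"
      using assms(5) n0 n by blast
    have kr: "real k = 2 * real n - 2 * real (c n) - 5"
      using arg_cong[OF k(1), of real] by simp
    have "real k = real n * (2 - 2 * x n - 5 * (1 / real n))"
      "real k + 1 = real n * (2 - 2 * x n - 4 * (1 / real n))"
      "real (c n + 1) = real n * (x n + 1 / real n)"
      "2 * real n - 1 = real n * (2 - 1 / real n)"
      using n0 by (simp_all add: kr x_def field_simps)
    then have eqs: "real n / (real k + 1) = 1 / (2 - 2 * x n - 4 * (1 / real n))"
      "real n * (1 - real (c n + 1) / real k) / (2 * real n - 1) =
        (1 - (x n + 1 / real n) / (2 - 2 * x n - 5 * (1 / real n))) / (2 - 1 / real n)"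
      using n0 by simp_all
    show ?thesis
      using multipartite_ratio_bounds[OF M rc k] unfolding eqs R L_def U_def by blast
  qed
  show ?thesis
    by (rule tendsto_sandwich[OF _ _ L U]; rule eventually_mono[OF ev]; use bounds[OF refl] in blast)
qed

end
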